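(* Let $G$ be a connected graph with diameter at most $4$. Then $vcfc(G)=3$ if and only if $G$ has more than one cut-vertex.
   Context: All graphs are simple, finite and undirected. In a vertex-colored graph (colorings are arbitrary and not required to be proper), a path is called conflict-free if there is a color used on exactly one of its vertices. A vertex-colored graph is conflict-free vertex-connected if every pair of distinct vertices is connected by a conflict-free path. For a connected graph $G$, the conflict-free vertex-connection number $vcfc(G)$ is the smallest number of colors in a vertex-coloring that makes $G$ conflict-free vertex-connected. *)

theory Defs
  imports "Graph_Theory.Graph_Theory"
begin

text \<open>
  Finite simple undirected graphs are the digraphs satisfying the predicate \<^const>\<open>graph\<close>: finite,
  symmetric, loop-free and without parallel arcs. An edge is represented by a pair of
  opposite arcs.
\<close>

text \<open>
  Distance is minimum walk cost with every arc weighing 1; it is \<open>\<infinity>\<close> between vertices that are not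
  joined by a walk, hence the type \<^typ>\<open>ereal\<close>.
\<close>

definition graph_dist :: "('a, 'b) pre_digraph \<Rightarrow> 'a \<Rightarrow> 'a \<Rightarrow> ereal" where
  "graph_dist G u v = wf_digraph.\<mu> G (\<lambda>_. 1) u v"

definition diameter :: "('a, 'b) pre_digraph \<Rightarrow> ereal" where
  "diameter G = (SUP u\<in>verts G. SUP v\<in>verts G. graph_dist G u v)"

text \<open>
  In a symmetric digraph the strongly connected components are the connected components, so this
  says that deleting \<open>v\<close> increases the number of components. The only vertex of a one-vertex graph
  is not a cut-vertex.
\<close>

definition cut_vertex :: "('a, 'b) pre_digraph \<Rightarrow> 'a \<Rightarrow> bool" where
  "cut_vertex G v \<longleftrightarrow> v \<in> verts G \<and>
     card (pre_digraph.sccs (pre_digraph.del_vert G v)) > card (pre_digraph.sccs G)"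

definition conflict_free :: "('a \<Rightarrow> 'c) \<Rightarrow> 'a list \<Rightarrow> bool" where
  "conflict_free c p \<longleftrightarrow> (\<exists>i. \<exists>!v. v \<in> set p \<and> c v = i)"

definition conflict_free_connected :: "('a, 'b) pre_digraph \<Rightarrow> ('a \<Rightarrow> 'c) \<Rightarrow> bool" where
  "conflict_free_connected G c \<longleftrightarrow>
     (\<forall>u\<in>verts G. \<forall>v\<in>verts G. u \<noteq> v \<longrightarrow>
        (\<exists>p. vpath p G \<and> hd p = u \<and> last p = v \<and> conflict_free c p))"

text \<open>
  The number of colors of a coloring is the number of colors occurring on vertices of the graph.
  Natural numbers provide enough colors for every finite graph.
\<close>

definition vcfc :: "('a, 'b) pre_digraph \<Rightarrow> nat" where
  "vcfc G = (LEAST k. \<exists>c :: 'a \<Rightarrow> nat. card (c ` verts G) = k \<and> conflict_free_connected G c)"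

end

theory Submission
  imports Defs
begin

text \<open>
  Suppose \<open>r\<close> is a vertex such that no vertex separates a cut-vertex from \<open>r\<close>. Color \<open>r\<close> with 2, the
  other cut-vertices with 1 and everything else with 0. Two vertices lie on a common path through
  \<open>r\<close>, which is conflict-free, unless a single vertex \<open>x\<close>, possibly one of the two, cuts both off from \<open>r\<close>; in that
  case the part cut off by \<open>x\<close> contains no cut-vertex, so it contains a path through \<open>x\<close>, on which
  \<open>x\<close> is the only vertex of color 1. If there is at most one cut-vertex, \<open>r\<close> can be chosen such
  that color 1 does not occur. In diameter at most 4 such an \<open>r\<close> always exists: take a
  cut-vertex separating two others if there is one, and any cut-vertex otherwise; a failure would
  yield four cut-vertices in a row and hence two vertices at distance at least 5.

  Conversely, let \<open>x\<close> and \<open>y\<close> be cut-vertices and let only two colors be used. Beyond \<open>x\<close> (seen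
  from \<open>y\<close>) there is a vertex \<open>a\<close> colored differently from \<open>x\<close>, and beyond \<open>y\<close> a vertex \<open>b\<close> colored
  differently from \<open>y\<close>. Every path from \<open>a\<close> to \<open>b\<close> contains \<open>x\<close> and \<open>y\<close>, so both colors repeat on it.
\<close>

section \<open>Walks as vertex lists\<close>

lemma vwalk_conv_successively:
  "vwalk p G \<longleftrightarrow>
     p \<noteq> [] \<and> set p \<subseteq> verts G \<and> successively (\<lambda>u v. (u, v) \<in> arcs_ends G) p"
proof -
  have "set (vwalk_arcs p) \<subseteq> arcs_ends G \<longleftrightarrow> successively (\<lambda>u v. (u, v) \<in> arcs_ends G) p"
    by (induction p rule: vwalk_arcs.induct) auto
  then show ?thesis
    by (auto simp: vwalk_def)
qed

lemma vwalk_append_Cons_iff: "vwalk (p @ x # q) G \<longleftrightarrow> vwalk (p @ [x]) G \<and> vwalk (x # q) G"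
  by (auto simp: vwalk_conv_successively successively_append_iff)

lemma vwalk_splice:
  assumes "vwalk (p @ y # p') G" "vwalk (y # s @ [z]) G" "vwalk (q @ z # q') G"
  shows "vwalk (p @ y # s @ z # q') G"
  using assms vwalk_append_Cons_iff[of p y p' G] vwalk_append_Cons_iff[of q z q' G]
    vwalk_append_Cons_iff[of p y "s @ z # q'" G] vwalk_append_Cons_iff[of "y # s" z q' G]
  by simp

text \<open>No vertex of a path repeats, so stopping at some \<open>x\<close> before the end keeps
  the end of \<open>p\<close> out of the prefix.\<close>

lemma vpath_prefix:
  assumes "vpath p G" "hd p = u" "x \<in> set p"
  obtains q where "vpath (q @ [x]) G" "hd (q @ [x]) = u"
    "x \<noteq> last p \<longrightarrow> last p \<notin> set q"
proof -
  obtain q q' where p: "p = q @ x # q'"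
    using assms(3) by (meson split_list)
  show thesis
  proof
    show "vpath (q @ [x]) G"
      using assms(1) by (auto simp: p vpath_def dest: vwalk_append_Cons_iff[THEN iffD1])
    show "hd (q @ [x]) = u"
      using assms(2) by (cases q) (auto simp: p)
    show "x \<noteq> last p \<longrightarrow> last p \<notin> set q"
      using assms(1) by (cases q' rule: rev_cases) (auto simp: p vpath_def)
  qed
qed

section \<open>Connection and separation relative to a single vertex\<close>

context pre_digraph
begin

text \<open>Component membership in \<open>G - x\<close>, expressed by paths of \<open>G\<close> so
  that walks need not be moved between graphs.\<close>

definition linked :: "'a \<Rightarrow> 'a \<Rightarrow> 'a \<Rightarrow> bool" where
  "linked x u v \<longleftrightarrow> (\<exists>p. vpath p G \<and> hd p = u \<and> last p = v \<and> x \<notin> set p)"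

text \<open>The inequalities rule out the trivial failure of \<open>linked\<close> at an end equal
  to \<open>x\<close>.\<close>

definition separates :: "'a \<Rightarrow> 'a \<Rightarrow> 'a \<Rightarrow> bool" where
  "separates x u v \<longleftrightarrow>
     u \<in> verts G \<and> v \<in> verts G \<and> x \<noteq> u \<and> x \<noteq> v \<and> \<not> linked x u v"

lemma linkedI:
  assumes "vwalk p G" "hd p = u" "last p = v" "x \<notin> set p"
  shows "linked x u v"
  unfolding linked_def using assms
  by (metis vwalk_to_vpath_hd vwalk_to_vpath_last vwalk_to_vpath_subset vwalk_to_vpath_vpath)

lemma linked_verts: "linked x u v \<Longrightarrow> u \<in> verts G \<and> v \<in> verts G \<and> x \<noteq> u \<and> x \<noteq> v"
  unfolding linked_def vpath_def vwalk_def by (metis hd_in_set last_in_set subsetD)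

lemma linked_refl: "u \<in> verts G \<Longrightarrow> x \<noteq> u \<Longrightarrow> linked x u u"
  by (rule linkedI[of "[u]"]) auto

lemma separates_neq: "separates x u v \<Longrightarrow> u \<noteq> v"
  using linked_refl by (auto simp: separates_def)

lemma linked_trans: "linked x u v \<Longrightarrow> linked x v w \<Longrightarrow> linked x u w"
proof -
  assume "linked x u v" "linked x v w"
  then obtain p q where p: "vwalk p G" "hd p = u" "last p = v" "x \<notin> set p"
    and q: "vwalk q G" "hd q = v" "last q = w" "x \<notin> set q"
    unfolding linked_def vpath_def by blast
  have "vwalk (p \<oplus> q) G" using p q by (intro vwalk_joinI_vwalk') auto
  moreover have "hd (p \<oplus> q) = u" "last (p \<oplus> q) = w"
    using p q by (auto simp: vwalk_join_hd' vwalk_join_last joinable_def vwalk_def)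
  moreover have "x \<notin> set (p \<oplus> q)"
    using p q by (auto simp: vwalk_join_def dest: list.set_sel(2)[rotated])
  ultimately show ?thesis by (rule linkedI)
qed

lemma linked_prefix:
  assumes "vwalk (p @ q) G" "x \<notin> set p" "v \<in> set p"
  shows "linked x (hd p) v"
proof -
  obtain r s where p: "p = r @ v # s"
    using assms(3) by (meson split_list)
  show ?thesis
  proof (rule linkedI[of "r @ [v]"])
    show "vwalk (r @ [v]) G"
      using assms(1) vwalk_append_Cons_iff[of r v "s @ q" G] by (simp add: p)
    show "hd (r @ [v]) = hd p" by (cases r) (auto simp: p)
  qed (use assms(2) in \<open>auto simp: p\<close>)
qed

end

section \<open>Paths through a prescribed vertex\<close>

context sym_digraph
begin

lemma vwalk_rev: "vwalk p G \<Longrightarrow> vwalk (rev p) G"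
  by (rule vwalk_rev_ex[OF sym_arcs])

lemma linked_sym:
  assumes "linked x u v"
  shows "linked x v u"
proof -
  obtain p where "vwalk p G" "hd p = u" "last p = v" "x \<notin> set p"
    using assms by (auto simp: linked_def vpath_def)
  then show ?thesis
    by (intro linkedI[of "rev p"]) (auto simp: vwalk_rev hd_rev last_rev)
qed

lemma separates_sym: "separates x u v \<Longrightarrow> separates x v u"
  using linked_sym by (auto simp: separates_def)

lemma separates_linked:
  assumes "separates x u v" "linked x u w"
  shows "separates x w v"
  using assms linked_verts[OF assms(2)] linked_trans by (auto simp: separates_def)

text \<open>
  The special case of Menger's theorem used here, by augmenting a tripod: \<open>A\<close> and \<open>B\<close> are disjoint
  legs starting in \<open>u\<close> and \<open>w\<close> and merging into the common tail \<open>T\<close> to \<open>r\<close>. A path avoiding the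
  merging point \<open>hd T\<close> allows one of the legs to be rerouted so that the tail becomes shorter.
\<close>

lemma vpath_via_root_aux:
  assumes "\<And>x. x \<noteq> r \<Longrightarrow> linked x u r \<or> linked x w r"
    and "distinct (A @ B @ T)" "vwalk (A @ T) G" "vwalk (B @ T) G"
    and "hd (A @ T) = u" "hd (B @ T) = w" "T \<noteq> []" "last T = r"
  shows "\<exists>p. vpath p G \<and> hd p = u \<and> last p = w \<and> r \<in> set p"
  using assms(2-)
proof (induction "length T" arbitrary: A B T rule: less_induct)
  case less
  obtain z T' where T: "T = z # T'" using less.prems by (cases T) auto
  show ?case
  proof (cases "T' = []")
    case True
    then have T: "T = [r]" using T less.prems by auto
    \<comment> \<open>The legs meet only in \<open>r\<close>, so one followed by the reverse of the
      other is the path.\<close>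
    have "vwalk (r # rev B) G"
      using vwalk_rev[of "B @ T"] less.prems by (simp add: T)
    then have "vwalk (A @ r # rev B) G"
      using less.prems by (simp add: T vwalk_append_Cons_iff[of A r "rev B"])
    moreover have "hd (A @ r # rev B) = u"
      using less.prems by (cases A) (auto simp: T)
    moreover have "last (A @ r # rev B) = w"
      using less.prems by (cases B) (auto simp: T)
    ultimately show ?thesis
      using less.prems by (intro exI[of _ "A @ r # rev B"]) (auto simp: vpath_def T)
  next
    case False
    then have r: "r \<in> set T'" "z \<noteq> r" using less.prems by (auto simp: T)
    then obtain R where R: "vpath R G" "hd R = u \<or> hd R = w" "last R = r" "z \<notin> set R"
      using assms(1)[of z] by (auto simp: linked_def)
    then have "R \<noteq> []" by (auto simp: vpath_def)
    with R have "hd R \<noteq> z" by auto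
    \<comment> \<open>An empty leg would make its start equal to \<open>z\<close>, so
      \<open>R\<close> starts on a nonempty leg.\<close>
    then have "hd R \<in> set A \<union> set B"
      using R(2) less.prems by (cases A; cases B) (auto simp: T)
    \<comment> \<open>\<open>y\<close> is the last vertex of \<open>R\<close> on a leg and
      \<open>z'\<close> the first one after it on the old tail; the segment \<open>S\<close> between
      them avoids the whole tripod.\<close>
    then obtain R1 y R2 where y: "R = R1 @ y # R2" "y \<in> set A \<union> set B"
      "\<forall>a\<in>set R2. a \<notin> set A \<union> set B"
      using \<open>R \<noteq> []\<close> split_list_last_prop[of R "\<lambda>a. a \<in> set A \<union> set B"]
      by (metis hd_in_set)
    have "R2 \<noteq> []"
      using R(3) y r less.prems by (auto simp: T)
    then have "r \<in> set R2"
      using R(3) y(1) by auto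
    then obtain S z' R3 where z': "R2 = S @ z' # R3" "z' \<in> set T'" "\<forall>a\<in>set S. a \<notin> set T'"
      using r split_list_first_prop[of R2 "\<lambda>a. a \<in> set T'"] by metis
    obtain T1 T2 where T': "T' = T1 @ z' # T2"
      using z'(2) by (meson split_list)
    have walkS: "vwalk (y # S @ [z']) G"
      using R(1) unfolding y(1) z'(1) vpath_def vwalk_conv_successively
      by (auto simp: successively_append_iff successively_Cons hd_append)
    have S: "distinct (y # S)" "z' \<notin> set S" "z \<notin> set S" "set S \<inter> (set A \<union> set B \<union> set T') = {}"
      using R(1,4) y(3) z'(3) unfolding y(1) z'(1) vpath_def by auto
    have last: "last (z' # T2) = r" using less.prems by (simp add: T T')
    show ?thesis
    proof (cases "y \<in> set A")
      case True
      then obtain A1 A2 where A: "A = A1 @ y # A2" by (meson split_list)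
      \<comment> \<open>The detour \<open>S\<close> takes the leg of \<open>y\<close> to
        \<open>z'\<close>, the other leg absorbs \<open>z # T1\<close>, and the tail shrinks to
        \<open>z' # T2\<close>.\<close>
      show ?thesis
      proof (rule less.hyps[of "z' # T2" "A1 @ y # S" "B @ z # T1"])
        show "vwalk ((A1 @ y # S) @ z' # T2) G"
          using vwalk_splice[OF _ walkS, of A1 "A2 @ T" "A @ z # T1" T2] less.prems(2)
          by (simp add: T T' A)
        show "hd ((A1 @ y # S) @ z' # T2) = u"
          using less.prems by (cases A1) (auto simp: A)
        show "distinct ((A1 @ y # S) @ (B @ z # T1) @ z' # T2)"
          using less.prems(1) S unfolding T T' A by auto
      qed (use less.prems last in \<open>auto simp: T T'\<close>)
    next
      case False
      then obtain B1 B2 where B: "B = B1 @ y # B2" using y(2) by (auto dest: split_list)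
      show ?thesis
      proof (rule less.hyps[of "z' # T2" "A @ z # T1" "B1 @ y # S"])
        show "vwalk ((B1 @ y # S) @ z' # T2) G"
          using vwalk_splice[OF _ walkS, of B1 "B2 @ T" "B @ z # T1" T2] less.prems(3)
          by (simp add: T T' B)
        show "hd ((B1 @ y # S) @ z' # T2) = w"
          using less.prems by (cases B1) (auto simp: B)
        show "distinct ((A @ z # T1) @ (B1 @ y # S) @ z' # T2)"
          using less.prems(1) S unfolding T T' B by auto
      qed (use less.prems last in \<open>auto simp: T T'\<close>)
    qed
  qed
qed

text \<open>The initial tripod consists of a path \<open>P\<close> from \<open>u\<close> to
  \<open>r\<close> and a path from \<open>w\<close>, stopped at its first vertex on
  \<open>P\<close>.\<close>

lemma vpath_via_root:
  assumes "\<And>x. x \<noteq> r \<Longrightarrow> linked x u r \<or> linked x w r"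
    and "u \<noteq> w" "u \<noteq> r" "w \<noteq> r"
  shows "\<exists>p. vpath p G \<and> hd p = u \<and> last p = w \<and> r \<in> set p"
proof -
  \<comment> \<open>For \<open>x = u\<close> the first alternative is impossible, since no path from
    \<open>u\<close> avoids \<open>u\<close>.\<close>
  have "linked u w r"
    using assms(1)[of u] assms(3) linked_verts by blast
  then obtain Q where Q: "vpath Q G" "hd Q = w" "last Q = r"
    by (auto simp: linked_def)
  have "linked w u r"
    using assms(1)[of w] assms(4) linked_verts by blast
  then obtain P where P: "vpath P G" "hd P = u" "last P = r"
    by (auto simp: linked_def)
  have ne: "P \<noteq> []" "Q \<noteq> []" using P(1) Q(1) by (auto simp: vpath_def)
  then have "r \<in> set P" "r \<in> set Q" using P(3) Q(3) last_in_set by metis+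
  then obtain B z Q' where z: "Q = B @ z # Q'" "z \<in> set P" "\<forall>b\<in>set B. b \<notin> set P"
    using split_list_first_prop[of Q "\<lambda>a. a \<in> set P"] by metis
  obtain A T where P': "P = A @ z # T" using z(2) by (meson split_list)
  show ?thesis
  proof (rule vpath_via_root_aux[OF assms(1), of A B "z # T"])
    show "vwalk (B @ z # T) G"
      using P(1) Q(1) unfolding P' z(1) vpath_def vwalk_conv_successively
      by (auto simp: successively_append_iff successively_Cons)
    show "distinct (A @ B @ z # T)"
      using P(1) Q(1) z(3) unfolding P' z(1) vpath_def by auto
    show "hd (B @ z # T) = w" using Q(2) by (cases B) (auto simp: z(1))
  qed (use P in \<open>auto simp: P' vpath_def\<close>)
qed

end

section \<open>Deleting a vertex\<close>

lemma (in wf_digraph) arcs_ends_del_vert: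
  "(u, v) \<in> arcs_ends (del_vert x) \<longleftrightarrow> (u, v) \<in> arcs_ends G \<and> u \<noteq> x \<and> v \<noteq> x"
  by (auto simp: arcs_ends_conv del_vert_simps)

lemma (in wf_digraph) vwalk_del_vert: "vwalk p (del_vert x) \<longleftrightarrow> vwalk p G \<and> x \<notin> set p"
  by (auto simp: vwalk_conv_successively verts_del_vert arcs_ends_del_vert
      cong: successively_cong elim!: successively_mono)

lemma (in wf_digraph) reachable_del_vert_iff: "u \<rightarrow>\<^sup>*\<^bsub>del_vert x\<^esub> v \<longleftrightarrow> linked x u v"
  unfolding wf_digraph.reachable_vpath_conv[OF wf_digraph_del_vert] linked_def vpath_def
  by (auto simp: vwalk_del_vert)

lemma conflict_freeI:
  assumes "x \<in> set p" "\<And>v. v \<in> set p \<Longrightarrow> v \<noteq> x \<Longrightarrow> c v \<noteq> c x"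
  shows "conflict_free c p"
  using assms unfolding conflict_free_def by metis

lemma conflict_free_rev: "conflict_free c (rev p) = conflict_free c p"
  by (simp add: conflict_free_def)

lemma vcfc_le: "conflict_free_connected G c \<Longrightarrow> vcfc G \<le> card (c ` verts G)" for c :: "'a \<Rightarrow> nat"
  unfolding vcfc_def by (rule Least_le) blast

lemma card_gt_1_iff: "finite S \<Longrightarrow> card S > 1 \<longleftrightarrow> (\<exists>a\<in>S. \<exists>b\<in>S. a \<noteq> b)"
  by (metis One_nat_def card_le_Suc0_iff_eq not_le)

section \<open>Cut-vertices as separators\<close>

locale connected_graph = pseudo_graph +
  assumes strongly_connected: "strongly_connected G"
begin

lemma ex_vpath:
  assumes "u \<in> verts G" "v \<in> verts G"
  obtains p where "vpath p G" "hd p = u" "last p = v"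
  using strongly_connected assms by (auto simp: strongly_connected_def reachable_vpath_conv)

lemma separates_mem:
  assumes "separates x u v" "vwalk p G" "hd p = u" "last p = v"
  shows "x \<in> set p"
  using assms linkedI by (auto simp: separates_def)

text \<open>Every path from \<open>u\<close> to \<open>v\<close> meets \<open>x\<close>, and its
  part up to \<open>x\<close> has not yet reached \<open>v\<close>. In particular, \<open>x\<close>
  is a vertex of \<open>G\<close>.\<close>

lemma separates_linked_to:
  assumes "separates x u v"
  shows "linked v u x"
proof -
  have "u \<in> verts G" "v \<in> verts G" "v \<noteq> x"
    using assms by (auto simp: separates_def)
  then obtain p where p: "vpath p G" "hd p = u" "last p = v"
    by (meson ex_vpath)
  then have "x \<in> set p" using assms separates_mem by (auto simp: vpath_def)
  then obtain q where q: "vpath (q @ [x]) G" "hd (q @ [x]) = u" "v \<notin> set q"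
    using vpath_prefix[OF p(1,2)] p(3) \<open>v \<noteq> x\<close> by metis
  show ?thesis
    by (rule linkedI[of "q @ [x]"]) (use q \<open>v \<noteq> x\<close> in \<open>auto simp: vpath_def\<close>)
qed

text \<open>\<open>G\<close> has one component, so being a cut-vertex means that
  \<open>scc_of\<close> takes at least two values on \<open>G - x\<close>, where its classes are
  those of \<open>linked x\<close>.\<close>

lemma cut_vertex_iff: "cut_vertex G x \<longleftrightarrow> (\<exists>u v. separates x u v)"
proof -
  let ?H = "del_vert x"
  interpret H: wf_digraph ?H by (rule wf_digraph_del_vert)
  have "card (pre_digraph.sccs ?H) = card (pre_digraph.scc_of ?H ` verts ?H)"
    using H.card_sccs_verts H.sccs_verts_conv_scc_of by simp
  moreover have "card sccs = 1"
    using strongly_connected strongly_connected_eq_iff by simp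
  moreover have "finite (pre_digraph.scc_of ?H ` verts ?H)"
    by (simp add: verts_del_vert)
  ultimately have "cut_vertex G x \<longleftrightarrow> x \<in> verts G \<and>
    (\<exists>u\<in>verts ?H. \<exists>v\<in>verts ?H. pre_digraph.scc_of ?H u \<noteq> pre_digraph.scc_of ?H v)"
    unfolding cut_vertex_def by (simp only: card_gt_1_iff) blast
  also have "\<dots> \<longleftrightarrow> x \<in> verts G \<and> (\<exists>u\<in>verts ?H. \<exists>v\<in>verts ?H. \<not> linked x u v)"
  proof -
    have "pre_digraph.scc_of ?H u = pre_digraph.scc_of ?H v \<longleftrightarrow> linked x u v"
      if "u \<in> verts ?H" "v \<in> verts ?H" for u v
    proof -
      have "linked x u u" using that linked_refl by (auto simp: verts_del_vert)
      then show ?thesis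
        unfolding H.scc_of_def reachable_del_vert_iff
        using linked_sym linked_trans by blast
    qed
    then show ?thesis by blast
  qed
  also have "\<dots> \<longleftrightarrow> x \<in> verts G \<and> (\<exists>u v. separates x u v)"
    by (auto simp: separates_def verts_del_vert)
  also have "\<dots> \<longleftrightarrow> (\<exists>u v. separates x u v)"
    using separates_linked_to linked_verts by blast
  finally show ?thesis .
qed

text \<open>Of two vertices separated by \<open>x\<close>, at most one shares a component of
  \<open>G - x\<close> with \<open>v\<close>; one that does not serves as \<open>u\<close>.\<close>

lemma cut_vertex_separates:
  assumes "cut_vertex G x" "v \<in> verts G" "v \<noteq> x"
  obtains u where "separates x u v"
proof -
  obtain a b where ab: "separates x a b" using assms(1) cut_vertex_iff by blast
  show thesis
  proof (cases "linked x b v")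
    case True
    then show ?thesis using ab that separates_linked separates_sym by blast
  next
    case False
    then show ?thesis using ab assms that[of b] by (auto simp: separates_def)
  qed
qed

text \<open>If \<open>b\<close> were on the side of \<open>a\<close>, then \<open>x\<close> would
  separate \<open>b\<close> from \<open>y\<close>, so \<open>b\<close> would reach \<open>x\<close>
  without passing \<open>y\<close>.\<close>

lemma separates_disjoint:
  assumes "separates x a y" "separates y b x"
  shows "\<not> linked x a b"
  using separates_linked_to[OF separates_linked[OF assms(1)]] assms(2)
  by (auto simp: separates_def)

section \<open>Choice of the root in small diameter\<close>

lemma ex_root_no_nested_cut_vertices:
  assumes short: "\<And>u v. u \<in> verts G \<Longrightarrow> v \<in> verts G \<Longrightarrow>
      \<exists>p. vwalk p G \<and> hd p = u \<and> last p = v \<and> length p \<le> 5"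
  shows "\<exists>r\<in>verts G. \<forall>x y. cut_vertex G y \<longrightarrow> \<not> separates x y r"
proof (rule ccontr)
  assume neg: "\<not> ?thesis"
  have nested: "\<exists>x y. cut_vertex G y \<and> separates x y r" if "r \<in> verts G" for r
    using neg that by blast
  obtain r where "r \<in> verts G"
    using strongly_connected by (auto simp: strongly_connected_def)
  then obtain c3 where c3: "cut_vertex G c3" using nested by blast
  \<comment> \<open>Failure at \<open>c3\<close> yields a vertex \<open>m\<close> between two
    cut-vertices; failure at \<open>m\<close> then yields \<open>x\<close> between \<open>m\<close>
    and a cut-vertex \<open>y\<close>.\<close>
  then obtain m c1 where c1: "cut_vertex G c1" "separates m c1 c3"
    using nested cut_vertex_def by metis
  have "m \<in> verts G" using separates_linked_to[OF c1(2)] linked_verts by blast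
  then obtain x y where xy: "cut_vertex G y" "separates x y m" using nested by blast
  \<comment> \<open>At least one of \<open>c1\<close> and \<open>c3\<close> lies in another
    component of \<open>G - m\<close> than \<open>y\<close>.\<close>
  have "\<exists>z. cut_vertex G z \<and> separates m y z"
  proof (cases "linked m c1 y")
    case True
    then show ?thesis using c1 c3 separates_linked by blast
  next
    case False
    then have "separates m y c1"
      using c1 xy separates_neq[OF xy(2)] linked_sym[of m y c1] by (auto simp: separates_def)
    then show ?thesis using c1 by blast
  qed
  then obtain z where z: "cut_vertex G z" "separates m y z" by blast
  have ne: "y \<noteq> m" "z \<noteq> m" "x \<noteq> y" "x \<noteq> m"
    using xy z by (auto simp: separates_def)
  \<comment> \<open>Seen from \<open>m\<close>, \<open>e\<close> is beyond \<open>y\<close> and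
    \<open>f\<close> beyond \<open>z\<close>: a walk from \<open>e\<close> to \<open>f\<close> meets
    \<open>y\<close>, \<open>x\<close>, \<open>m\<close>, \<open>z\<close> in this order.\<close>
  obtain e where e: "separates y e m"
    using cut_vertex_separates[OF xy(1) \<open>m \<in> verts G\<close>] ne by metis
  obtain f where f: "separates z f m"
    using cut_vertex_separates[OF z(1) \<open>m \<in> verts G\<close>] ne by metis
  have "linked m e y" "linked m f z"
    using e f by (auto intro: separates_linked_to)
  then have ef: "separates m e f"
    using z(2) by (meson linked_sym separates_linked separates_sym)
  then obtain p where p: "vwalk p G" "hd p = e" "last p = f" "length p \<le> 5"
    using short by (auto simp: separates_def)
  then have "m \<in> set p" using ef separates_mem by blast
  then obtain p1 p2 where p12: "p = p1 @ m # p2" by (meson split_list)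
  have walks: "vwalk (p1 @ [m]) G" "vwalk (m # p2) G"
    using p(1) vwalk_append_Cons_iff[of p1 m p2 G] by (auto simp: p12)
  have "m \<noteq> e" "m \<noteq> f" "e \<noteq> y" "f \<noteq> z"
    using e f ef by (auto simp: separates_def)
  have "hd (p1 @ [m]) = e" using p(2) by (cases p1) (auto simp: p12)
  then have "y \<in> set (p1 @ [m])" using separates_mem[OF e walks(1)] by simp
  then have "y \<in> set p1" using ne by simp
  then obtain q1 q2 where q: "p1 = q1 @ y # q2" by (meson split_list)
  have "q1 \<noteq> []" using \<open>hd (p1 @ [m]) = e\<close> \<open>e \<noteq> y\<close> by (auto simp: q)
  have "vwalk (y # q2 @ [m]) G"
    using walks(1) vwalk_append_Cons_iff[of q1 y "q2 @ [m]" G] by (simp add: q)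
  then have "x \<in> set (y # q2 @ [m])"
    using separates_mem[OF xy(2), of "y # q2 @ [m]"] by simp
  then have "q2 \<noteq> []" using ne by auto
  have "last (m # p2) = f" using p(3) by (simp add: p12)
  then have "z \<in> set (m # p2)"
    using separates_mem[OF separates_sym[OF f] walks(2)] by simp
  then have "z \<in> set p2" using ne by simp
  then obtain s1 s2 where s: "p2 = s1 @ z # s2" by (meson split_list)
  have "s2 \<noteq> []" using \<open>last (m # p2) = f\<close> \<open>f \<noteq> z\<close> by (auto simp: s)
  \<comment> \<open>The vertices \<open>e\<close>, \<open>y\<close>, \<open>x\<close>,
    \<open>m\<close>, \<open>z\<close>, \<open>f\<close> occupy six positions of
    \<open>p\<close>.\<close>
  have "length q1 \<ge> 1" "length q2 \<ge> 1" "length s2 \<ge> 1"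
    using \<open>q1 \<noteq> []\<close> \<open>q2 \<noteq> []\<close> \<open>s2 \<noteq> []\<close> by (simp_all add: Suc_le_eq)
  then show False using p(4) by (simp add: p12 q s)
qed

section \<open>The coloring and its conflict-free paths\<close>

definition cut_coloring :: "'a \<Rightarrow> 'a \<Rightarrow> nat" where
  "cut_coloring r v = (if v = r then 2 else if cut_vertex G v then 1 else 0)"

text \<open>With \<open>u\<close>, its whole component of \<open>G - x\<close> is cut off from
  \<open>r\<close>; by the choice of \<open>r\<close> it contains no cut-vertex, nor does it contain
  \<open>r\<close>.\<close>

lemma cut_coloring_separated:
  assumes root: "\<And>x y. cut_vertex G y \<Longrightarrow> \<not> separates x y r"
    and "separates x u r" "linked x u v"
  shows "cut_coloring r v = 0"
  using root[of v x] separates_linked[OF assms(2,3)] separates_neq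
  by (auto simp: cut_coloring_def)

lemma cut_coloring_separator: "separates x u r \<Longrightarrow> cut_coloring r x = 1"
  using cut_vertex_iff by (auto simp: cut_coloring_def separates_def)

text \<open>Before reaching \<open>x\<close>, a path from \<open>u\<close> stays in the part cut off
  from \<open>r\<close>, all of color 0, while the separator \<open>x\<close> has color 1.\<close>

lemma ex_conflict_free_to_separator:
  assumes root: "\<And>x y. cut_vertex G y \<Longrightarrow> \<not> separates x y r"
    and sep: "separates x u r"
  shows "\<exists>p. vpath p G \<and> hd p = u \<and> last p = x \<and> conflict_free (cut_coloring r) p"
proof -
  have "u \<in> verts G" "x \<in> verts G" "u \<noteq> x"
    using linked_verts[OF separates_linked_to[OF sep]] sep by (auto simp: separates_def)
  then obtain p where p: "vpath p G" "hd p = u" "last p = x" by (meson ex_vpath)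
  then have "p \<noteq> []" by (auto simp: vpath_def)
  then obtain q where q: "p = q @ [x]" using p(3) by (metis append_butlast_last_id)
  have "hd q = u" "x \<notin> set q"
    using p \<open>u \<noteq> x\<close> by (cases q; auto simp: q vpath_def)+
  then have "linked x u v" if "v \<in> set q" for v
    using linked_prefix[of q "[x]" x v] p(1) that by (auto simp: q vpath_def)
  then have "conflict_free (cut_coloring r) p"
    using cut_coloring_separated[OF root sep] cut_coloring_separator[OF sep]
    by (intro conflict_freeI[of x]) (auto simp: q)
  then show ?thesis using p by blast
qed

lemma cut_coloring_conflict_free_connected:
  assumes "r \<in> verts G" and root: "\<And>x y. cut_vertex G y \<Longrightarrow> \<not> separates x y r"
  shows "conflict_free_connected G (cut_coloring r)"
  unfolding conflict_free_connected_def
proof (intro ballI impI)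
  fix u w assume uw: "u \<in> verts G" "w \<in> verts G" "u \<noteq> w"
  let ?good = "\<lambda>u w. \<exists>p. vpath p G \<and> hd p = u \<and> last p = w \<and> conflict_free (cut_coloring r) p"
  have via_root: "conflict_free (cut_coloring r) p" if "r \<in> set p" for p
    using that by (intro conflict_freeI[of r]) (auto simp: cut_coloring_def)
  have good_sym: "?good v u" if "?good u v" for u v
  proof -
    obtain p where "vpath p G" "hd p = u" "last p = v" "conflict_free (cut_coloring r) p"
      using \<open>?good u v\<close> by blast
    then show ?thesis
      by (intro exI[of _ "rev p"])
        (auto simp: vpath_def hd_rev last_rev conflict_free_rev vwalk_rev)
  qed
  show "?good u w"
  proof (cases "u = r \<or> w = r")
    case True
    obtain p where p: "vpath p G" "hd p = u" "last p = w" using uw ex_vpath by metis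
    then have "r \<in> set p" using True by (metis hd_in_set last_in_set vpathE vwalk_def)
    then show ?thesis using p via_root by blast
  next
    case not_root: False
    show ?thesis
    proof (cases "\<forall>x. x \<noteq> r \<longrightarrow> linked x u r \<or> linked x w r")
      case True
      then show ?thesis using vpath_via_root[of r u w] uw(3) not_root via_root by blast
    next
      case False
      then obtain x where x: "x \<noteq> r" "\<not> linked x u r" "\<not> linked x w r" by blast
      have sep: "separates x v r" if "v \<in> {u, w}" "v \<noteq> x" for v
        using that x uw \<open>r \<in> verts G\<close> by (auto simp: separates_def)
      consider "u = x" | "w = x" | "u \<noteq> x" "w \<noteq> x" by blast
      then show ?thesis
      proof cases
        case 1
        then show ?thesis
          using ex_conflict_free_to_separator[OF root sep[of w]] uw(3) good_sym by blast
      next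
        case 2
        then show ?thesis
          using ex_conflict_free_to_separator[OF root sep[of u]] uw(3) by blast
      next
        case 3
        \<comment> \<open>A vertex \<open>x'\<close> cutting both off from \<open>x\<close> would be
          a cut-vertex inside a part cut off by \<open>x\<close>, against the choice of
          \<open>r\<close>; so \<open>vpath_via_root\<close> applies with \<open>x\<close> in place
          of \<open>r\<close>.\<close>
        have "linked x' u x \<or> linked x' w x" if "x' \<noteq> x" for x'
        proof (rule ccontr)
          assume *: "\<not> ?thesis"
          obtain v where v: "v \<in> {u, w}" "v \<noteq> x'" using uw(3) by auto
          then have "v \<noteq> x" using 3 by auto
          have sep_v: "separates x v r" using sep v \<open>v \<noteq> x\<close> by blast
          have "x \<in> verts G" using separates_linked_to[OF sep_v] linked_verts by blast
          then have "separates x' v x"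
            using * v uw \<open>x' \<noteq> x\<close> by (auto simp: separates_def)
          then have "cut_vertex G x'" "linked x v x'"
            using cut_vertex_iff separates_linked_to by blast+
          then show False using root separates_linked[OF sep_v] by blast
        qed
        then obtain p where p: "vpath p G" "hd p = u" "last p = w" "x \<in> set p"
          using vpath_via_root[of x u w] 3 uw(3) by blast
        then obtain p1 p2 where p12: "p = p1 @ x # p2" by (meson split_list)
        have u: "hd p1 = u" using p(2) 3 by (cases p1) (auto simp: p12)
        have w: "hd (rev p2) = w" using p(3) 3 by (cases p2 rule: rev_cases) (auto simp: p12)
        \<comment> \<open>Read from either end, the path stays in a part cut off by \<open>x\<close>
          until it meets \<open>x\<close>, so its other vertices have color 0.\<close>
        have "vwalk (rev p2 @ x # rev p1) G"
          using p(1) vwalk_rev[of p] by (simp add: p12 vpath_def)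
        then have "linked x u v \<or> linked x w v" if "v \<in> set p" "v \<noteq> x" for v
          using linked_prefix[of p1 "x # p2" x v] linked_prefix[of "rev p2" "x # rev p1" x v]
            that u w p(1) by (auto simp: p12 vpath_def)
        then have "cut_coloring r v = 0" if "v \<in> set p" "v \<noteq> x" for v
          using that cut_coloring_separated[OF root] sep 3 by blast
        moreover have "cut_coloring r x = 1"
          using sep[of u] 3 cut_coloring_separator by blast
        ultimately have "conflict_free (cut_coloring r) p"
          using p(4) by (intro conflict_freeI[of x]) auto
        then show ?thesis using p by blast
      qed
    qed
  qed
qed

section \<open>Two cut-vertices force three colors\<close>

lemma ex_separated_of_other_color:
  assumes cfc: "conflict_free_connected G c"
    and "cut_vertex G x" "y \<in> verts G" "y \<noteq> x"
  obtains a where "separates x a y" "c a \<noteq> c x"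
proof -
  obtain a where a: "separates x a y" using cut_vertex_separates assms by metis
  then have "a \<in> verts G" "x \<in> verts G" "a \<noteq> x"
    using assms(2) by (auto simp: separates_def cut_vertex_def)
  then obtain p where p: "vpath p G" "hd p = a" "last p = x" "conflict_free c p"
    using cfc unfolding conflict_free_connected_def by blast
  then have "p \<noteq> []" by (auto simp: vpath_def)
  then obtain q where q: "p = q @ [x]" using p(3) by (metis append_butlast_last_id)
  have hd: "hd q = a" "x \<notin> set q" "a \<in> set q"
    using p \<open>a \<noteq> x\<close> by (cases q; auto simp: q vpath_def)+
  \<comment> \<open>Were all of \<open>q\<close> colored like \<open>x\<close>, the only color on
    \<open>p\<close> would occur at both \<open>a\<close> and \<open>x\<close>. The vertex found
    precedes \<open>x\<close>, so it lies beyond \<open>x\<close> like \<open>a\<close>.\<close>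
  have "\<exists>v\<in>set q. c v \<noteq> c x"
    using p(4) hd unfolding conflict_free_def by (auto simp: q) metis
  then obtain v where v: "v \<in> set q" "c v \<noteq> c x" by blast
  have "linked x a v"
    using linked_prefix[of q "[x]" x v] p(1) v(1) hd by (auto simp: q vpath_def)
  then show thesis using that v(2) separates_linked[OF a] by blast
qed

lemma two_cut_vertices_imp_three_colors:
  assumes cfc: "conflict_free_connected G c"
    and "cut_vertex G x" "cut_vertex G y" "x \<noteq> y"
  shows "card (c ` verts G) \<ge> 3"
proof (rule ccontr)
  assume few: "\<not> ?thesis"
  have V: "x \<in> verts G" "y \<in> verts G" using assms by (auto simp: cut_vertex_def)
  obtain a where a: "separates x a y" "c a \<noteq> c x"
    using ex_separated_of_other_color[OF cfc assms(2)] V assms(4) by metis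
  obtain b where b: "separates y b x" "c b \<noteq> c y"
    using ex_separated_of_other_color[OF cfc assms(3)] V assms(4) by metis
  have two: "c v = i \<or> c v = j \<or> i = j"
    if "v \<in> verts G" "i \<in> c ` verts G" "j \<in> c ` verts G" for v i j
  proof (rule ccontr)
    assume "\<not> ?thesis"
    then have "card {c v, i, j} = 3" by auto
    moreover have "card {c v, i, j} \<le> card (c ` verts G)"
      using that by (intro card_mono) auto
    ultimately show False using few by simp
  qed
  have ab: "a \<in> verts G" "b \<in> verts G" "a \<noteq> x" "b \<noteq> y" "a \<noteq> y" "b \<noteq> x"
    using a(1) b(1) separates_neq[OF a(1)] separates_neq[OF b(1)] by (auto simp: separates_def)
  have sep: "\<not> linked x a b" "\<not> linked y b a"
    using separates_disjoint a(1) b(1) by blast+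
  then have "a \<noteq> b" using linked_refl[of a x] ab by auto
  then obtain p where p: "vpath p G" "hd p = a" "last p = b" "conflict_free c p"
    using cfc ab unfolding conflict_free_connected_def by blast
  have "x \<in> set p" "y \<in> set p"
    using sep p linkedI[of p a b x] linkedI[of p a b y] linked_sym by (auto simp: vpath_def)
  moreover have "a \<in> set p" "b \<in> set p"
    using p by (auto simp: vpath_def)
  moreover obtain i v where v: "v \<in> set p" "c v = i" "\<forall>w\<in>set p. c w = i \<longrightarrow> w = v"
    using p(4) unfolding conflict_free_def by metis
  moreover have "v \<in> verts G" using v(1) p(1) by (auto simp: vpath_def vwalk_def)
  \<comment> \<open>\<open>{a, x}\<close> and \<open>{b, y}\<close> are disjoint and each carries
    both colors, so no color occurs only once on \<open>p\<close>.\<close>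
  ultimately show False
    using two[of a "c x" "c y"] two[of b "c x" "c y"] two[of v "c x" "c a"] two[of b "c x" "c a"]
      two[of v "c x" "c y"] a(2) b(2) V ab \<open>a \<noteq> b\<close> \<open>x \<noteq> y\<close> by (metis imageI)
qed

section \<open>From the diameter to the value of \<open>vcfc\<close>\<close>

lemma ex_short_vwalk:
  assumes "diameter G \<le> 4" "u \<in> verts G" "v \<in> verts G"
  shows "\<exists>p. vwalk p G \<and> hd p = u \<and> last p = v \<and> length p \<le> 5"
proof -
  have "graph_dist G u v \<le> (SUP v\<in>verts G. graph_dist G u v)"
    using assms by (intro SUP_upper)
  also have "\<dots> \<le> diameter G"
    unfolding diameter_def using assms by (intro SUP_upper)
  \<comment> \<open>A strict bound on the infimum yields an actual walk of cost below 5.\<close>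
  also have "\<dots> < 5" using assms(1) by (rule le_less_trans) simp
  finally obtain p where p: "awalk u p v" "awalk_cost (\<lambda>_. 1) p < 5"
    by (auto simp: graph_dist_def \<mu>_def INF_less_iff)
  have "awalk_cost (\<lambda>_. 1) p = real (length p)"
    by (induction p) auto
  \<comment> \<open>Fewer than five arcs means at most five vertices.\<close>
  then have "length (awalk_verts u p) \<le> 5" using p(2) by (simp add: length_awalk_verts)
  then show ?thesis
    using awalk_imp_vwalk[OF p(1)] p(1) by (intro exI[of _ "awalk_verts u p"]) auto
qed

lemma finite_cut_vertices: "finite {v. cut_vertex G v}"
  by (rule finite_subset[OF _ finite_verts]) (auto simp: cut_vertex_def)

lemma vcfc_le_2:
  assumes "card {v. cut_vertex G v} \<le> 1"
  shows "vcfc G \<le> 2"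
proof -
  have unique: "v = w" if "cut_vertex G v" "cut_vertex G w" for v w
    using assms that card_gt_1_iff[OF finite_cut_vertices] by (metis mem_Collect_eq not_le)
  obtain r0 where "r0 \<in> verts G"
    using strongly_connected by (auto simp: strongly_connected_def)
  \<comment> \<open>The cut-vertex if there is one, any vertex otherwise.\<close>
  then obtain r where r: "r \<in> verts G" "\<And>v. cut_vertex G v \<Longrightarrow> v = r"
    using unique by (metis cut_vertex_def)
  \<comment> \<open>The root condition holds because every cut-vertex is \<open>r\<close>, which
    nothing separates from itself.\<close>
  have "conflict_free_connected G (cut_coloring r)"
    using r separates_neq by (intro cut_coloring_conflict_free_connected) blast+
  then have "vcfc G \<le> card (cut_coloring r ` verts G)" by (rule vcfc_le)
  also have "\<dots> \<le> card {0, 2 :: nat}"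
    using r by (intro card_mono) (auto simp: cut_coloring_def)
  finally show ?thesis by simp
qed

lemma vcfc_eq_3:
  assumes "card {v. cut_vertex G v} > 1" "diameter G \<le> 4"
  shows "vcfc G = 3"
proof (rule antisym)
  obtain r where r: "r \<in> verts G" "\<And>x y. cut_vertex G y \<Longrightarrow> \<not> separates x y r"
    using ex_root_no_nested_cut_vertices ex_short_vwalk assms(2) by metis
  then have good: "conflict_free_connected G (cut_coloring r)"
    by (rule cut_coloring_conflict_free_connected)
  then have "vcfc G \<le> card (cut_coloring r ` verts G)" by (rule vcfc_le)
  also have "\<dots> \<le> card {0, 1, 2 :: nat}"
    by (intro card_mono) (auto simp: cut_coloring_def)
  finally show "vcfc G \<le> 3" by simp
  obtain x y where "cut_vertex G x" "cut_vertex G y" "x \<noteq> y"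
    using assms(1) card_gt_1_iff[OF finite_cut_vertices] by blast
  \<comment> \<open>By \<open>good\<close> some coloring qualifies, so the minimum is attained and
    the lower bound applies to an optimal coloring.\<close>
  moreover have "\<exists>c :: 'a \<Rightarrow> nat. card (c ` verts G) = vcfc G \<and> conflict_free_connected G c"
    unfolding vcfc_def by (rule LeastI_ex) (use good in blast)
  ultimately show "3 \<le> vcfc G"
    using two_cut_vertices_imp_three_colors by metis
qed

end

theorem corollary3p10:
  fixes G :: "('a, 'b) pre_digraph"
  assumes "graph G"
    and "connected G"
    and "diameter G \<le> 4"
  shows "vcfc G = 3 \<longleftrightarrow> card {v. cut_vertex G v} > 1"
proof -
  interpret graph G by fact
  interpret connected_graph G
    using assms(2) by unfold_locales (rule symmetric_connected_imp_strongly_connected[OF sym_arcs])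
  show ?thesis
    \<comment> \<open>With at most one cut-vertex, \<open>vcfc G\<close> is at most 2 and hence not
      3.\<close>
    using vcfc_le_2 vcfc_eq_3[OF _ assms(3)] by fastforce
qed

end
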